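(* Let $m\le n$ be positive integers and let $\rho:\{0,1\}^n\to\{0,1\}^n$ be the generalized rotation with parameter $m$. Let $w\in\{0,1\}^n$, let $p$ be the smallest positive integer with $\rho^p(w)=w$, and let $a(w)$ be the number of $1$'s in $w$. For $j=1,\dots,n$ define the multisets \[ L^{(j)}=\Big\{\textstyle\sum_{i=0}^{j-1}\rho^k(w)_i \;\Big|\; k=0,1,\dots,p-1\Big\},\qquad R^{(j)}=\Big\{\textstyle\sum_{i=0}^{j-1}\rho^k(w)_{n-i-1} \;\Big|\; k=0,1,\dots,p-1\Big\}, \] (each with $p$ elements counted with multiplicity), and let $L^{(0)}=R^{(0)}$ be the multiset consisting of $p$ copies of $0$. Then for $j=0,1,\dots,n-1$ we have $L^{(j)}=R^{(j)}$ as multisets, i.e. for every $s\in\{0,1,\dots,a(w)\}$, \[ \#\Big\{k\in\{0,\dots,p-1\}: \textstyle\sum_{i=0}^{j-1}\rho^k(w)_i=s\Big\}=\#\Big\{k\in\{0,\dots,p-1\}: \textstyle\sum_{i=0}^{j-1}\rho^k(w)_{n-i-1}=s\Big\}. \]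
   Context: For a word $w=w_0w_1\cdots w_{n-1}\in\{0,1\}^n$, $w_i$ is its $i$-th letter and $w_{[i,j]}=w_iw_{i+1}\cdots w_j$. The generalized rotation $\rho$ (with parameter $m$, $1\le m\le n$) is defined by: if there is $k<m$ such that $w_{[0,k]}=1^k0$ (i.e. $w$ begins with exactly $k$ ones followed by a $0$), then $\rho(w)=w_{k+1}w_{k+2}\cdots w_{n-1}\,0\,1^k$; otherwise (i.e. $w$ begins with $m$ ones) $\rho(w)=w_mw_{m+1}\cdots w_{n-1}1^m$. Here $1^k$ denotes $k$ consecutive ones. $\rho$ is a bijection, and for $m=1$ it is the ordinary cyclic shift. $\rho^k(w)_i$ denotes the $i$-th letter of $\rho^k(w)$. *)

theory Defs
  imports "HOL-Library.Multiset" "HOL-Combinatorics.Cycles"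
begin

definition words :: "nat \<Rightarrow> nat list set" where
  "words n = {w. length w = n \<and> set w \<subseteq> {0, 1}}"

definition starts_ones_zero :: "nat list \<Rightarrow> nat \<Rightarrow> bool" where
  "starts_ones_zero w k \<longleftrightarrow> take (Suc k) w = replicate k 1 @ [0]"

(* At most one k satisfies starts_ones_zero w k, so the description operator picks out
   the k of the condition; see rho_ones_zero and rho_ones below. *)
definition rho :: "nat \<Rightarrow> nat list \<Rightarrow> nat list" where
  "rho m w =
     (if \<exists>k<m. starts_ones_zero w k
      then let k = (THE k. k < m \<and> starts_ones_zero w k)
           in drop (Suc k) w @ [0] @ replicate k 1
      else drop m w @ replicate m 1)"

definition left_sum :: "nat \<Rightarrow> nat list \<Rightarrow> nat" where
  "left_sum j u = (\<Sum>i<j. u ! i)"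

definition right_sum :: "nat \<Rightarrow> nat list \<Rightarrow> nat" where
  "right_sum j u = (\<Sum>i<j. u ! (length u - i - 1))"

(* least_power f w is the least positive p with (f ^^ p) w = w.  For j = 0 both multisets
   consist of p copies of the empty sum 0. *)
definition left_mset :: "nat \<Rightarrow> nat list \<Rightarrow> nat \<Rightarrow> nat multiset" where
  "left_mset m w j =
     image_mset (\<lambda>k. left_sum j ((rho m ^^ k) w)) (mset_set {..<least_power (rho m) w})"

definition right_mset :: "nat \<Rightarrow> nat list \<Rightarrow> nat \<Rightarrow> nat multiset" where
  "right_mset m w j =
     image_mset (\<lambda>k. right_sum j ((rho m ^^ k) w)) (mset_set {..<least_power (rho m) w})"

lemma starts_ones_zero_iff:
  "starts_ones_zero w k \<longleftrightarrow> (\<exists>v. w = replicate k 1 @ 0 # v)"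
proof
  assume "starts_ones_zero w k"
  then have "w = (replicate k 1 @ [0]) @ drop (Suc k) w"
    unfolding starts_ones_zero_def by (metis append_take_drop_id)
  then show "\<exists>v. w = replicate k 1 @ 0 # v" by auto
qed (auto simp: starts_ones_zero_def)

lemma ones_zero_prefix_le:
  assumes "replicate k 1 @ 0 # v = replicate l 1 @ (x :: nat list)"
  shows "l \<le> k"
proof (rule ccontr)
  assume "\<not> l \<le> k"
  then have "(replicate l 1 @ x) ! k = 1" by (simp add: nth_append)
  moreover have "(replicate k 1 @ 0 # v) ! k = 0" by (simp add: nth_append)
  ultimately show False using assms by simp
qed

lemma starts_ones_zero_unique:
  "starts_ones_zero w k \<Longrightarrow> starts_ones_zero w l \<Longrightarrow> k = l"
  unfolding starts_ones_zero_iff by (metis le_antisym ones_zero_prefix_le)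

lemma rho_ones_zero:
  assumes "k < m"
  shows "rho m (replicate k 1 @ 0 # v) = v @ 0 # replicate k 1"
proof -
  let ?w = "replicate k 1 @ 0 # v"
  have k: "starts_ones_zero ?w k" unfolding starts_ones_zero_iff by blast
  then have "(THE l. l < m \<and> starts_ones_zero ?w l) = k"
    using assms starts_ones_zero_unique by blast
  then show ?thesis using assms k unfolding rho_def by auto
qed

lemma rho_ones: "rho m (replicate m 1 @ v) = v @ replicate m 1"
proof -
  have "\<not> (\<exists>k<m. starts_ones_zero (replicate m 1 @ v) k)"
    unfolding starts_ones_zero_iff by (metis leD ones_zero_prefix_le)
  then show ?thesis unfolding rho_def by (subst if_not_P) simp_all
qed

lemma words_cases:
  assumes "w \<in> words n" and "m \<le> n"
  obtains (zero) k v where "k < m" "w = replicate k 1 @ 0 # v"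
        | (ones) v where "w = replicate m 1 @ v"
proof -
  have "(\<exists>k<m. \<exists>v. w = replicate k 1 @ 0 # v) \<or> (\<exists>v. w = replicate m 1 @ v)"
    using assms(2)
  proof (induction m)
    case (Suc m)
    show ?case
    proof (cases "\<exists>k<m. \<exists>v. w = replicate k 1 @ 0 # v")
      case False
      then obtain v where v: "w = replicate m 1 @ v" using Suc by auto
      then obtain x u where x: "v = x # u"
        using Suc.prems assms(1) by (cases v) (auto simp: words_def)
      then have "x = 0 \<or> x = 1" using v assms(1) by (auto simp: words_def)
      then show ?thesis using v x by (auto simp: replicate_app_Cons_same)
    qed (use less_SucI in blast)
  qed simp
  then show thesis using that by blast
qed

lemma rho_in_words:
  assumes "w \<in> words n" and "m \<le> n"
  shows "rho m w \<in> words n"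
  using assms
proof (rule words_cases)
  fix k v assume "k < m" "w = replicate k 1 @ 0 # v"
  then show ?thesis
    using assms(1) by (auto simp: rho_ones_zero words_def simp del: One_nat_def)
next
  fix v assume "w = replicate m 1 @ v"
  then show ?thesis
    using assms(1) by (auto simp: rho_ones words_def simp del: One_nat_def)
qed

lemma rev_rho_rev_rho:
  assumes "w \<in> words n" and "m \<le> n"
  shows "rev (rho m (rev (rho m w))) = w"
  using assms
  by (rule words_cases) (simp_all add: rho_ones_zero rho_ones del: One_nat_def)

lemma bij_betw_rho:
  assumes "m \<le> n"
  shows "bij_betw (rho m) (words n) (words n)"
proof (rule bij_betw_byWitness[where f' = "\<lambda>w. rev (rho m (rev w))"])
  have rev: "rev w \<in> words n" if "w \<in> words n" for w
    using that by (simp add: words_def)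
  show "\<forall>w\<in>words n. rev (rho m (rev (rho m w))) = w"
    using assms rev_rho_rev_rho by blast
  show "\<forall>w\<in>words n. rho m (rev (rho m (rev w))) = w"
    using assms rev rev_rho_rev_rho by (metis rev_rev_ident)
  show "rho m ` words n \<subseteq> words n" using assms rho_in_words by blast
  show "(\<lambda>w. rev (rho m (rev w))) ` words n \<subseteq> words n"
    using assms rev rho_in_words by blast
qed

end

theory Submission
  imports Defs
begin

text \<open>Write a word with \<open>c > 0\<close> zeros as its list of runs of ones, and split each run length \<open>r\<close> as
  \<open>r = m * q + e\<close> with \<open>e < m\<close>. While the first run has at least \<open>m\<close> ones, the generalized rotation
  moves \<open>m\<close> ones from the first run to the last; otherwise it turns the first run into a new last one.
  Hence along the orbit the quotients form a sequence of period \<open>c\<close> and the remainders a sequence of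
  period \<open>c + 1\<close>. A prefix of length \<open>j\<close> contains more than \<open>d\<close> zeros iff its first \<open>d + 1\<close>
  runs have total length less than \<open>j - d\<close>, so it suffices that sums of the first \<open>d + 1\<close> runs and of
  the last \<open>d + 1\<close> runs are equidistributed; this follows from shifting the index by \<open>c + 1\<close>,
  which fixes the remainders and acts on the quotients as a shift by one.\<close>

section \<open>Sums of periodic sequences\<close>

lemma sum_lessThan_add:
  fixes h :: "nat \<Rightarrow> nat"
  shows "(\<Sum>k<a + b. h k) = (\<Sum>k<a. h k) + (\<Sum>k<b. h (a + k))"
  by (induction b) simp_all

lemma sum_periodic_shift:
  fixes h :: "nat \<Rightarrow> nat"
  assumes "\<And>u. h (u + N) = h u"
  shows "(\<Sum>u<N. h (u + a)) = (\<Sum>u<N. h u)"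
proof (induction a)
  case (Suc a)
  have "(\<Sum>u<N. h (u + Suc a)) + h a = (\<Sum>u<Suc N. h (u + a))"
    by (subst sum.lessThan_Suc_shift) simp
  also have "\<dots> = (\<Sum>u<N. h (u + a)) + h a"
    using assms[of a] by (simp add: add.commute)
  finally show ?case using Suc by simp
qed simp

lemma sum_periodic_mult:
  fixes h :: "nat \<Rightarrow> nat"
  assumes "\<And>u. h (u + p) = h u"
  shows "(\<Sum>u<K * p. h u) = K * (\<Sum>u<p. h u)"
proof (induction K)
  case (Suc K)
  have "h (K * p + u) = h u" for u
  proof (induction K)
    case (Suc K)
    then show ?case using assms[of "K * p + u"] by (simp add: ac_simps)
  qed simp
  then show ?case using Suc sum_lessThan_add[of h "K * p" p] by (simp add: add.commute)
qed simp

lemma funpow_mult_fixpoint: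
  assumes "(f ^^ p) x = x"
  shows "(f ^^ (K * p)) x = x"
  by (induction K) (simp_all add: funpow_add assms)

text \<open>The remainder of \<open>P\<close> modulo the least return time is itself a return time,
  so minimality forces it to be 0.\<close>

lemma least_power_props:
  assumes "(f ^^ P) x = x" and "0 < P"
  shows "(f ^^ least_power f x) x = x" and "0 < least_power f x"
    and "least_power f x dvd P"
proof -
  let ?p = "least_power f x"
  have p: "(f ^^ ?p) x = x \<and> 0 < ?p"
    unfolding least_power_def by (rule LeastI[of _ P]) (use assms in simp)
  then show "(f ^^ ?p) x = x" "0 < ?p" by simp_all
  have "(f ^^ (P mod ?p + P div ?p * ?p)) x = x" using assms(1) by (simp only: mod_div_mult_eq)
  then have "(f ^^ (P mod ?p)) x = x"
    using funpow_mult_fixpoint[of ?p f x] p by (simp add: funpow_add del: mod_div_mult_eq)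
  moreover have "P mod ?p < ?p" using p by simp
  ultimately have "P mod ?p = 0"
    using not_less_Least[of "P mod ?p" "\<lambda>n. (f ^^ n) x = x \<and> 0 < n"]
    unfolding least_power_def by auto
  then show "?p dvd P" by auto
qed

section \<open>Words given by their runs of ones\<close>

text \<open>Here \<open>c\<close> counts the zeros. Only \<open>f 0\<close>, ..., \<open>f c\<close>
  matter, hence \<open>run_word_cong\<close>.\<close>

primrec run_word :: "(nat \<Rightarrow> nat) \<Rightarrow> nat \<Rightarrow> nat list" where
  "run_word f 0 = replicate (f 0) 1"
| "run_word f (Suc c) = replicate (f 0) 1 @ 0 # run_word (\<lambda>i. f (Suc i)) c"

lemma run_word_cong:
  "(\<And>i. i \<le> c \<Longrightarrow> f i = g i) \<Longrightarrow> run_word f c = run_word g c"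
proof (induction c arbitrary: f g)
  case (Suc c)
  have "run_word (\<lambda>i. f (Suc i)) c = run_word (\<lambda>i. g (Suc i)) c"
    by (rule Suc.IH) (simp add: Suc.prems)
  then show ?case using Suc.prems[of 0] by simp
qed simp

lemma run_word_Suc_right:
  "run_word f (Suc c) = run_word f c @ 0 # replicate (f (Suc c)) 1"
proof (induction c arbitrary: f)
  case (Suc c)
  show ?case by (subst run_word.simps(2), subst Suc.IH) simp
qed simp

lemma rev_run_word: "rev (run_word f c) = run_word (\<lambda>i. f (c - i)) c"
proof (induction c arbitrary: f)
  case (Suc c)
  have "run_word (\<lambda>i. f (Suc i)) c = rev (run_word (\<lambda>i. f (Suc (c - i))) c)"
    using Suc.IH[of "\<lambda>i. f (Suc i)"] by (metis rev_rev_ident)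
  moreover have "run_word (\<lambda>i. f (Suc c - i)) c = run_word (\<lambda>i. f (Suc (c - i))) c"
    by (rule run_word_cong) (simp add: Suc_diff_le)
  ultimately show ?case
    by (simp only: run_word_Suc_right[of "\<lambda>i. f (Suc c - i)"]) simp
qed simp

lemma run_word_append_ones:
  "run_word f c @ replicate k 1 = run_word (f(c := f c + k)) c"
proof (cases c)
  case (Suc b)
  have "run_word (f(Suc b := f (Suc b) + k)) b = run_word f b" by (rule run_word_cong) simp
  then show ?thesis using Suc by (simp add: run_word_Suc_right replicate_add del: run_word.simps(2))
qed (simp add: replicate_add)

lemma ones_append_run_word:
  assumes "k \<le> f 0"
  shows "run_word f c = replicate k 1 @ run_word (f(0 := f 0 - k)) c"
proof -
  have "replicate (f 0) (1::nat) = replicate k 1 @ replicate (f 0 - k) 1"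
    using assms by (metis le_add_diff_inverse replicate_add)
  then show ?thesis by (cases c) simp_all
qed

lemma rho_run_word_ge:
  assumes "m \<le> f 0" and "0 < c"
  shows "rho m (run_word f c) = run_word (f(0 := f 0 - m, c := f c + m)) c"
proof -
  have "rho m (run_word f c) = run_word (f(0 := f 0 - m)) c @ replicate m 1"
    by (subst ones_append_run_word[of m f, OF assms(1)]) (rule rho_ones)
  then show ?thesis
    using assms(2) run_word_append_ones[of "f(0 := f 0 - m)" c m] by simp
qed

lemma rho_run_word_less:
  assumes "f 0 < m"
  shows "rho m (run_word f (Suc b)) = run_word (\<lambda>i. if i \<le> b then f (Suc i) else f 0) (Suc b)"
proof -
  have "rho m (run_word f (Suc b)) = run_word (\<lambda>i. f (Suc i)) b @ 0 # replicate (f 0) 1"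
    using rho_ones_zero[OF assms] by simp
  also have "run_word (\<lambda>i. f (Suc i)) b = run_word (\<lambda>i. if i \<le> b then f (Suc i) else f 0) b"
    by (rule run_word_cong) simp
  finally show ?thesis by (simp add: run_word_Suc_right del: run_word.simps(2))
qed

lemma ex_run_word:
  assumes "set w \<subseteq> {0, 1}"
  shows "\<exists>f c. w = run_word f c"
  using assms
proof (induction w)
  case Nil
  have "[] = run_word (\<lambda>_. 0) 0" by simp
  then show ?case by blast
next
  case (Cons x w)
  then obtain f c where w: "w = run_word f c" by auto
  consider "x = 0" | "x = 1" using Cons.prems by auto
  then show ?case
  proof cases
    case 1
    have "x # w = run_word (case_nat 0 f) (Suc c)" using 1 w by simp
    then show ?thesis by blast
  next
    case 2
    have "x # w = run_word (f(0 := Suc (f 0))) c" using 2 w by (cases c) simp_all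
    then show ?thesis by blast
  qed
qed

text \<open>Counting zeros from 0, zero number \<open>d\<close> exists iff \<open>d < c\<close>, and
  it stands behind \<open>d\<close> zeros and the runs \<open>f 0\<close>, ..., \<open>f d\<close>,
  which gives its position.\<close>

lemma zeros_take_run_word:
  "d < count_list (take j (run_word f c)) 0 \<longleftrightarrow> d < c \<and> (\<Sum>i\<le>d. f i) + d < j"
proof (induction c arbitrary: f j d)
  case 0
  then show ?case by (simp add: min_def)
next
  case (Suc c)
  show ?case
  proof (cases "j \<le> f 0")
    case True
    moreover have "f 0 \<le> (\<Sum>i\<le>d. f i)" by (rule member_le_sum) auto
    ultimately show ?thesis by simp
  next
    case False
    then obtain k where j: "j = f 0 + Suc k" by (metis add_Suc_right less_imp_Suc_add not_le)
    show ?thesis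
    proof (cases d)
      case 0
      then show ?thesis using j by simp
    next
      case (Suc d')
      show ?thesis using Suc.IH[of d' k "\<lambda>i. f (Suc i)"] j Suc
        by (simp add: sum.atMost_Suc_shift del: sum.atMost_Suc)
    qed
  qed
qed

section \<open>The orbit of a word with a zero\<close>

text \<open>The word at stage \<open>u\<close> has the runs with indices \<open>u\<close>, ...,
  \<open>u + c\<close>. The first and the last share one quotient, as
  \<open>q (u + c) = q u\<close>; a first run moved to the end gets index \<open>u + Suc c\<close>
  and keeps its remainder.\<close>

locale run_orbit =
  fixes m c :: nat and q e :: "nat \<Rightarrow> nat"
  assumes c_pos: "0 < c"
    and q_period: "q (u + c) = q u"
    and e_period: "e (u + Suc c) = e u"
    and e_less: "e u < m"
begin

text \<open>The word reached from \<open>state 0 0\<close> once \<open>u\<close> zeros have been moved to the right end and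
  afterwards \<open>i\<close> blocks of \<open>m\<close> ones.\<close>

definition state_runs :: "nat \<Rightarrow> nat \<Rightarrow> nat \<Rightarrow> nat" where
  "state_runs u i l =
     (if l = 0 then m * (q u - i) + e u
      else if l < c then m * q (u + l) + e (u + l)
      else m * i + e (u + c))"

definition state :: "nat \<Rightarrow> nat \<Rightarrow> nat list" where
  "state u i = run_word (state_runs u i) c"

text \<open>Stage \<open>v\<close> takes \<open>q v\<close> moves of \<open>m\<close> ones and one
  move of a zero.\<close>

definition time :: "nat \<Rightarrow> nat" where
  "time u = (\<Sum>v<u. Suc (q v))"

text \<open>A common period of \<open>q\<close> and \<open>e\<close>; the orbit may close
  earlier.\<close>

definition N :: nat where "N = c * Suc c"

lemma q_period_N: "q (u + N) = q u"
proof -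
  have "q (u + k * c) = q u" for k
  proof (induction k)
    case (Suc k)
    then show ?case using q_period[of "u + k * c"] by (simp add: ac_simps)
  qed simp
  then show ?thesis by (metis N_def mult.commute)
qed

lemma e_period_N: "e (u + N) = e u"
proof -
  have "e (u + k * Suc c) = e u" for k
  proof (induction k)
    case (Suc k)
    then show ?case using e_period[of "u + k * Suc c"] by (simp add: ac_simps)
  qed simp
  then show ?thesis by (simp only: N_def)
qed

lemma q_period_N': "q (u + N + l) = q (u + l)"
  using q_period_N[of "u + l"] by (simp only: ac_simps)

lemma e_period_N': "e (u + N + l) = e (u + l)"
  using e_period_N[of "u + l"] by (simp only: ac_simps)

lemma rho_state_inner:
  assumes "i < q u"
  shows "rho m (state u i) = state u (Suc i)"
proof -
  have eq: "m * (q u - i) = m + m * (q u - Suc i)"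
    using assms by (metis Suc_diff_Suc mult_Suc_right)
  then have "rho m (state u i) = run_word ((state_runs u i)
      (0 := state_runs u i 0 - m, c := state_runs u i c + m)) c"
    unfolding state_def using c_pos by (intro rho_run_word_ge) (simp_all add: state_runs_def)
  also have "\<dots> = state u (Suc i)"
    unfolding state_def by (rule run_word_cong) (use eq c_pos in \<open>auto simp: state_runs_def\<close>)
  finally show ?thesis .
qed

text \<open>The first run is down to \<open>e u < m\<close> ones, so it moves whole, together with
  its zero.\<close>

lemma rho_state_last: "rho m (state u (q u)) = state (Suc u) 0"
proof -
  obtain b where b: "c = Suc b" using c_pos by (cases c) auto
  have less: "state_runs u (q u) 0 < m" using e_less by (simp add: state_runs_def)
  have "rho m (state u (q u)) =
      run_word (\<lambda>i. if i \<le> b then state_runs u (q u) (Suc i) else state_runs u (q u) 0) c"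
    using rho_run_word_less[of "state_runs u (q u)", OF less, of b]
    by (simp only: state_def b[symmetric])
  also have "\<dots> = state (Suc u) 0"
    unfolding state_def
  proof (rule run_word_cong)
    fix i assume "i \<le> c"
    \<comment> \<open>At \<open>i = b\<close> stands the former last run, matched by the period of
      \<open>q\<close>; at \<open>i = c\<close> the moved first run, matched by the period of
      \<open>e\<close>.\<close>
    then consider "i < b" | "i = b" | "i = c" using b by linarith
    then show "(if i \<le> b then state_runs u (q u) (Suc i) else state_runs u (q u) 0)
        = state_runs (Suc u) 0 i"
      using b q_period[of u] e_period[of u] unfolding state_runs_def by cases auto
  qed
  finally show ?thesis .
qed

lemma funpow_state:
  assumes "i \<le> q u"
  shows "(rho m ^^ i) (state u 0) = state u i"
  using assms by (induction i) (simp_all add: rho_state_inner)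

lemma funpow_time: "(rho m ^^ time u) (state 0 0) = state u 0"
proof (induction u)
  case (Suc u)
  have "(rho m ^^ time (Suc u)) (state 0 0) = (rho m ^^ Suc (q u)) ((rho m ^^ time u) (state 0 0))"
    by (simp only: time_def sum.lessThan_Suc add.commute[of _ "Suc _"] funpow_add comp_apply)
  then show ?case using Suc by (simp add: funpow_state rho_state_last)
qed (simp add: time_def)

lemma state_N: "state N 0 = state 0 0"
  unfolding state_def
  by (rule run_word_cong)
    (use q_period_N'[of 0] e_period_N'[of 0] q_period_N[of 0] e_period_N[of 0] in
      \<open>auto simp: state_runs_def\<close>)

lemma time_N_pos: "0 < time N"
  using c_pos unfolding time_def N_def by (intro sum_pos) auto

lemma sum_time:
  fixes g :: "nat list \<Rightarrow> nat"
  shows "(\<Sum>k<time u. g ((rho m ^^ k) (state 0 0))) = (\<Sum>v<u. \<Sum>i\<le>q v. g (state v i))"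
proof (induction u)
  case (Suc u)
  have "(rho m ^^ (time u + i)) (state 0 0) = state u i" if "i \<le> q u" for i
    using that funpow_time funpow_state by (simp add: funpow_add add.commute[of "time u"])
  then have "(\<Sum>i<Suc (q u). g ((rho m ^^ (time u + i)) (state 0 0))) = (\<Sum>i\<le>q u. g (state u i))"
    by (simp add: lessThan_Suc_atMost)
  moreover have "time (Suc u) = time u + Suc (q u)" by (simp add: time_def)
  ultimately show ?case using Suc by (simp only: sum_lessThan_add sum.lessThan_Suc[of _ u])
qed (simp add: time_def)

text \<open>As \<open>d < c\<close> excludes the last run, \<open>i\<close> enters only through the
  first run.\<close>

lemma sum_state_runs:
  assumes "d < c"
  shows "(\<Sum>l\<le>d. state_runs u i l) =
    (\<Sum>l\<le>d. e (u + l)) + m * ((\<Sum>l<d. q (Suc u + l)) + (q u - i))"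
  using assms
proof (induction d)
  case (Suc d)
  have "state_runs u i (Suc d) = e (u + Suc d) + m * q (Suc u + d)"
    using Suc.prems by (simp add: state_runs_def)
  moreover have "(\<Sum>l\<le>d. state_runs u i l) =
      (\<Sum>l\<le>d. e (u + l)) + m * ((\<Sum>l<d. q (Suc u + l)) + (q u - i))"
    using Suc by simp
  ultimately show ?case
    by (simp only: sum.atMost_Suc sum.lessThan_Suc distrib_left ac_simps)
qed (simp add: state_runs_def)

text \<open>As \<open>d < c\<close> excludes the first run, \<open>i\<close> enters only through the
  last run.\<close>

lemma sum_state_runs_rev:
  assumes "d < c"
  shows "(\<Sum>l\<le>d. state_runs u i (c - l)) =
    (\<Sum>l\<le>d. e (u + c - d + l)) + m * ((\<Sum>l<d. q (u + c - d + l)) + i)"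
  using assms
proof (induction d)
  case 0
  then show ?case by (simp add: state_runs_def)
next
  case (Suc d)
  \<comment> \<open>Increasing \<open>d\<close> extends the window of indices on the left, so the
    new term is split off at the front.\<close>
  then have "Suc (u + c - Suc d) = u + c - d" by simp
  then have "(\<Sum>l\<le>Suc d. e (u + c - Suc d + l)) = e (u + c - Suc d) + (\<Sum>l\<le>d. e (u + c - d + l))"
    and "(\<Sum>l<Suc d. q (u + c - Suc d + l)) = q (u + c - Suc d) + (\<Sum>l<d. q (u + c - d + l))"
    by (simp_all only: sum.atMost_Suc_shift sum.lessThan_Suc_shift add_Suc_right add_Suc[symmetric] add_0_right)
  moreover have "state_runs u i (c - Suc d) = m * q (u + c - Suc d) + e (u + c - Suc d)"
    using Suc.prems by (simp add: state_runs_def)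
  ultimately show ?case using Suc by (simp add: algebra_simps)
qed

text \<open>For a fixed window of remainders, the quotient total runs over \<open>A (Suc u)\<close>,
  ..., \<open>B u\<close> for first runs and over \<open>A u\<close>, ..., \<open>B u\<close> for
  last runs. Adding the missing initial segments makes both sides equal to the same full sum, and
  the segments agree after a shift by \<open>Suc c\<close>.\<close>

lemma sum_state_runs_symmetric:
  fixes g :: "nat \<Rightarrow> nat"
  assumes "d < c"
  shows "(\<Sum>u<N. \<Sum>i\<le>q u. g (\<Sum>l\<le>d. state_runs u i l)) =
    (\<Sum>u<N. \<Sum>i\<le>q u. g (\<Sum>l\<le>d. state_runs u i (c - l)))"
proof -
  define E where "E u = (\<Sum>l\<le>d. e (u + l))" for u
  define A where "A u = (\<Sum>l<d. q (u + l))" for u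
  define B where "B u = (\<Sum>l\<le>d. q (u + l))" for u
  define G where "G u y = g (E u + m * y)" for u y
  have E_N: "E (u + N) = E u" and A_N: "A (u + N) = A u" for u
    unfolding E_def A_def by (simp_all only: e_period_N' q_period_N')
  have E_c: "E (u + Suc c) = E u" for u
    unfolding E_def using e_period[of "u + _"] by (intro sum.cong) (simp_all add: ac_simps)
  have A_c: "A (u + Suc c) = A (Suc u)" for u
    unfolding A_def using q_period[of "Suc u + _"] by (intro sum.cong) (simp_all add: ac_simps)
  have B_left: "B u = A (Suc u) + q u" for u
    unfolding A_def B_def by (cases d) (simp_all add: sum.atMost_shift lessThan_Suc_atMost)
  have B_right: "B u = A u + q (u + d)" for u
    unfolding A_def B_def by (simp add: lessThan_Suc_atMost[symmetric])
  have split: "(\<Sum>y\<le>a + b. G u y) = (\<Sum>y<a. G u y) + (\<Sum>i\<le>b. G u (a + i))" for a b u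
    using sum_lessThan_add[of "G u" a "Suc b"] by (simp only: lessThan_Suc_atMost add_Suc_right)
  \<comment> \<open>The contribution of the last \<open>d + 1\<close> runs, indexed by the start
    \<open>v = u + (c - d)\<close> of their window; then \<open>q (v + d) = q u\<close>.\<close>
  define H where "H v = (\<Sum>i\<le>q (v + d). G v (A v + i))" for v

  have "(\<Sum>u<N. \<Sum>i\<le>q u. g (\<Sum>l\<le>d. state_runs u i l)) = (\<Sum>u<N. \<Sum>i\<le>q u. G u (A (Suc u) + (q u - i)))"
    using sum_state_runs[OF assms] by (simp add: G_def E_def A_def)
  also have "\<dots> = (\<Sum>u<N. \<Sum>i\<le>q u. G u (A (Suc u) + i))"
  proof (rule sum.cong[OF refl])
    show "(\<Sum>i\<le>q u. G u (A (Suc u) + (q u - i))) = (\<Sum>i\<le>q u. G u (A (Suc u) + i))" for u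
      by (rule sum.reindex_bij_witness[where i = "\<lambda>i. q u - i" and j = "\<lambda>i. q u - i"]) auto
  qed
  finally have left: "(\<Sum>u<N. \<Sum>i\<le>q u. g (\<Sum>l\<le>d. state_runs u i l)) + (\<Sum>u<N. \<Sum>y<A (Suc u). G u y)
      = (\<Sum>u<N. \<Sum>y\<le>B u. G u y)"
    by (simp only: B_left split sum.distrib)

  have "(\<Sum>u<N. \<Sum>i\<le>q u. g (\<Sum>l\<le>d. state_runs u i (c - l))) = (\<Sum>u<N. H (u + (c - d)))"
  proof (rule sum.cong[OF refl])
    fix u
    have "u + (c - d) + d = u + c" and "u + c - d = u + (c - d)" using assms by simp_all
    then show "(\<Sum>i\<le>q u. g (\<Sum>l\<le>d. state_runs u i (c - l))) = H (u + (c - d))"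
      by (simp only: H_def G_def E_def A_def sum_state_runs_rev[OF assms] q_period)
  qed
  also have "\<dots> = (\<Sum>v<N. H v)"
    by (rule sum_periodic_shift) (simp only: H_def G_def E_N A_N q_period_N')
  finally have right: "(\<Sum>u<N. \<Sum>i\<le>q u. g (\<Sum>l\<le>d. state_runs u i (c - l))) + (\<Sum>u<N. \<Sum>y<A u. G u y)
      = (\<Sum>u<N. \<Sum>y\<le>B u. G u y)"
    by (simp only: H_def B_right split sum.distrib)

  \<comment> \<open>The shift by \<open>Suc c\<close> fixes \<open>E\<close> and turns
    \<open>A u\<close> into \<open>A (Suc u)\<close>.\<close>
  have "(\<Sum>u<N. \<Sum>y<A u. G u y) = (\<Sum>u<N. \<Sum>y<A (u + Suc c). G (u + Suc c) y)"
    by (rule sum_periodic_shift[symmetric]) (simp only: G_def E_N A_N)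
  also have "\<dots> = (\<Sum>u<N. \<Sum>y<A (Suc u). G u y)"
    by (simp only: G_def E_c A_c)
  finally show ?thesis using left right by simp
qed

lemma sum_zeros_state_symmetric:
  "(\<Sum>u<N. \<Sum>i\<le>q u. of_bool (d < count_list (take j (state u i)) 0) :: nat) =
   (\<Sum>u<N. \<Sum>i\<le>q u. of_bool (d < count_list (take j (rev (state u i))) 0))"
proof (cases "d < c")
  case True
  then show ?thesis
    using sum_state_runs_symmetric[OF True, of "\<lambda>t. of_bool (t + d < j)"]
    by (simp add: state_def rev_run_word zeros_take_run_word)
qed (simp add: state_def rev_run_word zeros_take_run_word)

end

lemma run_word_in_orbit:
  assumes "1 \<le> m" and "0 < c"
  obtains q e i where "run_orbit m c q e" and "run_word f c = run_orbit.state m c q e 0 i"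
    and "i \<le> q 0"
proof -
  \<comment> \<open>The first and last quotients are merged into \<open>q 0\<close>; the part
    \<open>f c div m\<close> counts as already moved and serves as \<open>i\<close>.\<close>
  define q where "q l = (if l mod c = 0 then f 0 div m + f c div m else f (l mod c) div m)" for l
  define e where "e l = f (l mod Suc c) mod m" for l
  interpret run_orbit m c q e
    by unfold_locales (use assms in \<open>auto simp: q_def e_def simp del: add_Suc_right\<close>)
  have "run_word f c = state 0 (f c div m)"
    unfolding state_def
    by (rule run_word_cong) (use assms in \<open>auto simp: state_runs_def q_def e_def\<close>)
  then show thesis
    using that[of q e "f c div m"] run_orbit_axioms by (simp add: q_def)
qed

section \<open>Equidistribution\<close>

text \<open>The least period divides \<open>time N\<close>, so sums over \<open>time N\<close> steps
  are a positive multiple of the sums over one period.\<close>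

lemma orbit_zeros_symmetric:
  assumes "1 \<le> m" and "m \<le> n" and "w \<in> words n"
  shows "(\<Sum>k<least_power (rho m) w. of_bool (d < count_list (take j ((rho m ^^ k) w)) 0) :: nat) =
    (\<Sum>k<least_power (rho m) w. of_bool (d < count_list (take j (rev ((rho m ^^ k) w))) 0))"
proof -
  let ?x = "\<lambda>w k. (rho m ^^ k) w"
  let ?p = "least_power (rho m) w"
  obtain f c where w: "w = run_word f c"
    using assms(3) ex_run_word[of w] by (auto simp: words_def)
  show ?thesis
  proof (cases c)
    \<comment> \<open>Without zeros the word consists of ones and is fixed by
      \<open>rho m\<close>.\<close>
    case 0
    then have "w = replicate m 1 @ replicate (n - m) 1"
      using w assms by (simp add: words_def replicate_add[symmetric])
    then have "rho m w = w"
      using rho_ones[of m "replicate (n - m) 1"] assms(2) by (simp add: replicate_add[symmetric])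
    then have "?x w k = w" for k by (induction k) simp_all
    then show ?thesis using w 0 by simp
  next
    case (Suc b)
    then obtain q e i where orbit: "run_orbit m c q e"
      and w_state: "w = run_orbit.state m c q e 0 i" and i: "i \<le> q 0"
      using run_word_in_orbit[OF assms(1), of c f] w by auto
    interpret run_orbit m c q e by (rule orbit)
    let ?w0 = "state 0 0" and ?P = "time N"
    have w0: "?x ?w0 i = w" using funpow_state[OF i] w_state by simp
    have P: "?x ?w0 ?P = ?w0" using funpow_time state_N by simp
    have "?x ?w0 (?P + i) = ?x ?w0 (i + ?P)" by (simp only: add.commute)
    then have "?x w ?P = w" by (simp add: funpow_add w0 P)
    note p = least_power_props[OF this time_N_pos]
    obtain K where K: "?P = K * ?p" using p(3) by (metis dvdE mult.commute)
    have avg: "K * (\<Sum>k<?p. g (?x w k)) = (\<Sum>v<N. \<Sum>i\<le>q v. g (state v i))"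
      for g :: "nat list \<Rightarrow> nat"
    proof -
      have "K * (\<Sum>k<?p. g (?x w k)) = (\<Sum>k<?P. g (?x w k))"
        unfolding K by (rule sum_periodic_mult[symmetric]) (simp add: funpow_add p(1))
      also have "\<dots> = (\<Sum>k<?P. g (?x ?w0 (k + i)))"
        by (simp add: funpow_add w0)
      also have "\<dots> = (\<Sum>k<?P. g (?x ?w0 k))"
        by (rule sum_periodic_shift) (simp add: funpow_add P)
      finally show ?thesis by (simp only: sum_time)
    qed
    have "K > 0" using time_N_pos K by (cases K) auto
    moreover have "K * (\<Sum>k<?p. of_bool (d < count_list (take j (?x w k)) 0)) =
        K * (\<Sum>k<?p. of_bool (d < count_list (take j (rev (?x w k))) 0))"
      using avg[of "\<lambda>v. of_bool (d < count_list (take j v) 0)"]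
        avg[of "\<lambda>v. of_bool (d < count_list (take j (rev v)) 0)"]
        sum_zeros_state_symmetric[of d j] by (simp only:)
    ultimately show ?thesis by simp
  qed
qed

section \<open>From counts of zeros to equality of multisets\<close>

lemma sum_list_binary:
  assumes "set u \<subseteq> {0, 1 :: nat}"
  shows "sum_list u = length u - count_list u 0"
proof -
  have "sum_list u + count_list u 0 = length u" using assms by (induction u) auto
  then show ?thesis by simp
qed

lemma left_sum_zeros:
  assumes "u \<in> words n" and "j \<le> n"
  shows "left_sum j u = j - count_list (take j u) 0"
proof -
  have "left_sum j u = sum_list (take j u)"
    using assms by (simp add: left_sum_def sum_list_sum_nth words_def atLeast0LessThan)
  also have "\<dots> = j - count_list (take j u) 0"
    using assms set_take_subset[of j u] by (subst sum_list_binary) (auto simp: words_def)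
  finally show ?thesis .
qed

lemma right_sum_rev:
  assumes "j \<le> length u"
  shows "right_sum j u = left_sum j (rev u)"
  unfolding right_sum_def left_sum_def
  using assms by (intro sum.cong) (simp_all add: rev_nth)

text \<open>The multiplicity of \<open>s\<close> is the number of values at least \<open>s\<close>
  minus the number of values above \<open>s\<close>; the former is again a tail count, or
  \<open>s = 0\<close> and all values count.\<close>

lemma image_mset_eq_of_tails:
  fixes f g :: "'a \<Rightarrow> nat"
  assumes "finite A" and tails: "\<And>d. (\<Sum>k\<in>A. of_bool (d < f k) :: nat) = (\<Sum>k\<in>A. of_bool (d < g k))"
  shows "image_mset f (mset_set A) = image_mset g (mset_set A)"
proof (rule multiset_eqI)
  fix s
  have ge: "(\<Sum>k\<in>A. of_bool (s \<le> f k) :: nat) = (\<Sum>k\<in>A. of_bool (s \<le> g k))"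
    by (cases s) (simp_all add: Suc_le_eq tails del: sum_of_bool_eq)
  have "count (image_mset h (mset_set A)) s + (\<Sum>k\<in>A. of_bool (s < h k)) = (\<Sum>k\<in>A. of_bool (s \<le> h k))"
    for h :: "'a \<Rightarrow> nat"
  proof -
    have "count (image_mset h (mset_set A)) s = (\<Sum>k\<in>A. of_bool (h k = s))"
      using assms(1) by (simp add: count_image_mset_eq_card_vimage Int_def)
    moreover have "of_bool (h k = s) + of_bool (s < h k) = (of_bool (s \<le> h k) :: nat)" for k
      by auto
    ultimately show ?thesis by (simp only: sum.distrib[symmetric])
  qed
  from this[of f] this[of g]
  show "count (image_mset f (mset_set A)) s = count (image_mset g (mset_set A)) s"
    using ge tails[of s] by linarith
qed

theorem theorem1:
  fixes m n j :: nat and w :: "nat list"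
  assumes "1 \<le> m" and "m \<le> n" and "w \<in> words n" and "j < n"
  shows "left_mset m w j = right_mset m w j \<and>
    (\<forall>s \<le> count_list w 1.
       card {k. k < least_power (rho m) w \<and> (\<Sum>i<j. (rho m ^^ k) w ! i) = s} =
       card {k. k < least_power (rho m) w \<and> (\<Sum>i<j. (rho m ^^ k) w ! (n - i - 1)) = s})"
proof -
  let ?x = "\<lambda>k. (rho m ^^ k) w"
  let ?A = "{..<least_power (rho m) w}"
  have x: "?x k \<in> words n" for k
    by (induction k) (simp_all add: assms rho_in_words)
  then have rev_x: "rev (?x k) \<in> words n" and len: "length (?x k) = n" for k
    by (simp_all add: words_def)
  have left: "left_sum j (?x k) = j - count_list (take j (?x k)) 0" for k
    using left_sum_zeros[OF x] assms(4) by simp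
  have right: "right_sum j (?x k) = j - count_list (take j (rev (?x k))) 0" for k
    using left_sum_zeros[OF rev_x] right_sum_rev[of j "?x k"] assms(4) len by simp
  have "image_mset (\<lambda>k. count_list (take j (?x k)) 0) (mset_set ?A) =
      image_mset (\<lambda>k. count_list (take j (rev (?x k))) 0) (mset_set ?A)"
    by (intro image_mset_eq_of_tails orbit_zeros_symmetric[OF assms(1-3)]) simp
  then have "image_mset ((-) j) (image_mset (\<lambda>k. count_list (take j (?x k)) 0) (mset_set ?A)) =
      image_mset ((-) j) (image_mset (\<lambda>k. count_list (take j (rev (?x k))) 0) (mset_set ?A))"
    by (rule arg_cong)
  then have msets: "left_mset m w j = right_mset m w j"
    by (simp only: left_mset_def right_mset_def left right image_mset.compositionality comp_def)
  have "card {k. k < least_power (rho m) w \<and> (\<Sum>i<j. ?x k ! i) = s} =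
      card {k. k < least_power (rho m) w \<and> (\<Sum>i<j. ?x k ! (n - i - 1)) = s}" for s
    using arg_cong[OF msets, of "\<lambda>M. count M s"]
    by (simp add: left_mset_def right_mset_def left_sum_def right_sum_def len
        count_image_mset_eq_card_vimage)
  then show ?thesis using msets by blast
qed

end
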